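(* $\Gamma_S(S_n)$ is a cograph if and only if $n=3$. Moreover, $\Gamma_S(A_n)$ is a cograph if and only if $n\le 4$.
   Context: $S_n$ and $A_n$ are the symmetric and alternating groups on $n$ symbols. For a group $G$ with identity $e$, the intersection subgroup graph $\Gamma_S(G)$ is the simple graph whose vertices are the non-trivial subgroups $H$ of $G$ such that $H\cap K=\{e\}$ for some non-trivial subgroup $K$ of $G$; two distinct vertices $H,K$ are adjacent if and only if $H\cap K=\{e\}$. The vertex set may be empty; the null graph is regarded as a cograph. A graph is a cograph if it has no induced subgraph isomorphic to the path $P_4$ on four vertices.
   Formalization: The claim on Γ_S(S_n) is stated for n ≥ 3 only, since for n ≤ 2 the graph Γ_S(S_n) is null and hence a cograph although n ≠ 3; the claim on A_n is for all n. *)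

theory Defs
  imports "HOL-Algebra.Sym_Groups" "Graph_Theory.Graph_Theory"
begin

text \<open>
  Following Graph_Theory, an undirected simple graph is a loop-free symmetric digraph whose
  arcs are pairs of vertices: an edge between \<open>u\<close> and \<open>v\<close> is the pair of arcs \<open>(u, v)\<close>, \<open>(v, u)\<close>.
\<close>

definition path_graph :: "nat \<Rightarrow> nat pair_pre_digraph" where
  "path_graph n = \<lparr> pverts = {..<n},
     parcs = {(i, j). i < n \<and> j < n \<and> (j = Suc i \<or> i = Suc j)} \<rparr>"

definition cograph :: "('a, 'b) pre_digraph \<Rightarrow> bool" where
  "cograph G \<longleftrightarrow> \<not> (\<exists>H. induced_subgraph H G \<and> digraph_iso H (with_proj (path_graph 4)))"

text \<open>Non-trivial means different from the identity subgroup; the whole group is allowed.\<close>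

definition nontrivial_subgroups :: "('a, 'b) monoid_scheme \<Rightarrow> 'a set set" where
  "nontrivial_subgroups G = {H. subgroup H G \<and> H \<noteq> {\<one>\<^bsub>G\<^esub>}}"

definition intersection_subgroup_graph :: "('a, 'b) monoid_scheme \<Rightarrow> 'a set pair_pre_digraph" where
  "intersection_subgroup_graph G =
    (let V = {H \<in> nontrivial_subgroups G. \<exists>K \<in> nontrivial_subgroups G. H \<inter> K = {\<one>\<^bsub>G\<^esub>}}
     in \<lparr> pverts = V, parcs = {(H, K). H \<in> V \<and> K \<in> V \<and> H \<noteq> K \<and> H \<inter> K = {\<one>\<^bsub>G\<^esub>}} \<rparr>)"

text \<open>
  Both graphs are simple graphs in the above sense. Well-formedness matters for \<^const>\<open>cograph\<close>,
  since \<^const>\<open>induced_subgraph\<close> is only ever true of well-formed digraphs.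
\<close>

lemma pair_graph_path_graph: "pair_graph (path_graph n)"
proof -
  have sub: "parcs (path_graph n) \<subseteq> {..<n} \<times> {..<n}"
    and verts: "pverts (path_graph n) = {..<n}"
    by (auto simp: path_graph_def)
  show ?thesis
  proof unfold_locales
    show "finite (parcs (path_graph n))"
      using sub by (rule finite_subset) auto
    show "symmetric (with_proj (path_graph n))"
      unfolding symmetric_def with_proj_simps by (rule symI) (auto simp: path_graph_def)
  qed (use sub verts in \<open>auto simp: path_graph_def\<close>)
qed

lemma pair_bidirected_intersection_subgroup_graph:
  "pair_bidirected_digraph (intersection_subgroup_graph G)"
proof unfold_locales
  show "symmetric (with_proj (intersection_subgroup_graph G))"
    unfolding symmetric_def with_proj_simps
    by (rule symI) (auto simp: intersection_subgroup_graph_def Let_def)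
qed (simp_all only: intersection_subgroup_graph_def Let_def pair_pre_digraph.simps mem_Collect_eq
  split_beta fst_conv snd_conv simp_thms)

end

theory Submission
  imports Defs "HOL-Algebra.Multiplicative_Group" "HOL-Computational_Algebra.Primes"
begin

text \<open>
  An induced path \<open>A - B - C - D\<close> amounts to subgroups with \<open>A \<inter> B\<close>, \<open>B \<inter> C\<close>, \<open>C \<inter> D\<close> trivial and
  \<open>A \<inter> C\<close>, \<open>A \<inter> D\<close>, \<open>B \<inter> D\<close> non-trivial. In \<open>S\<^sub>n\<close>, \<open>n \<ge> 4\<close>, take the permutations of
  \<open>{1,2,3,4}\<close> stabilising \<open>{1,2}\<close>, then \<open>Alt {1,2,3}\<close>, \<open>Sym {3,4}\<close> and \<open>Sym {1,2,3}\<close>. In \<open>A\<^sub>n\<close>,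
  \<open>n \<ge> 5\<close>, take \<open>Alt {1,2,3,4}\<close>, \<open>Alt {1,2,5}\<close>, \<open>Alt {1,3,4}\<close> and the even permutations of
  \<open>{1,2,3,4,5}\<close> stabilising \<open>{1,2,5}\<close>. In the remaining groups every proper non-trivial subgroup
  has prime order, except for the Klein four-group in \<open>A\<^sub>4\<close>, and one exception is too few for a path.
\<close>

section \<open>Cographs and embedded four-vertex paths\<close>

text \<open>An induced subgraph of a pair digraph keeps \<open>fst\<close> and \<open>snd\<close> as
  tail and head, so its arcs are determined by their ends and an isomorphism onto the path amounts
  to its vertex map. The inverse of that map is \<open>f\<close>; conversely the image of
  \<open>f\<close> induces a path.\<close>

lemma cograph_with_proj_iff:
  assumes "pair_wf_digraph G"
  shows "cograph (with_proj G) \<longleftrightarrow>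
    (\<nexists>f. inj_on f {..<4} \<and> f ` {..<4} \<subseteq> pverts G \<and>
      (\<forall>i<4. \<forall>j<4. (f i, f j) \<in> parcs G \<longleftrightarrow> (i, j) \<in> parcs (path_graph 4)))"
    (is "_ \<longleftrightarrow> (\<nexists>f. ?path f)")
proof -
  interpret pair_wf_digraph G by fact
  have path: "\<exists>f. ?path f" if ind: "induced_subgraph H (with_proj G)"
    and iso: "digraph_iso H (with_proj (path_graph 4))" for H
  proof -
    from ind have sub: "verts H \<subseteq> pverts G" and tailH: "tail H = fst" and headH: "head H = snd"
      and arcsH: "arcs H = {e \<in> parcs G. fst e \<in> verts H \<and> snd e \<in> verts H}"
      unfolding induced_subgraph_def subgraph_def compatible_def by auto
    from iso obtain h where h: "pre_digraph.digraph_isomorphism H h"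
      and app: "with_proj (path_graph 4) = app_iso h H"
      unfolding digraph_iso_def by blast
    let ?v = "iso_verts h" and ?a = "iso_arcs h"
    have inj: "inj_on ?v (verts H)"
      and ends: "\<And>e. e \<in> arcs H \<Longrightarrow> ?v (fst e) = iso_tail h (?a e) \<and> ?v (snd e) = iso_head h (?a e)"
      using h unfolding pre_digraph.digraph_isomorphism_def by (auto simp: tailH headH)
    have vimg: "?v ` verts H = {..<4}"
      using arg_cong[OF app, of verts] by (simp add: verts_app_iso path_graph_def)
    have aimg: "?a ` arcs H = parcs (path_graph 4)"
      using arg_cong[OF app, of arcs] by (simp add: arcs_app_iso)
    \<comment> \<open>\<open>app_iso\<close> takes the tail and head functions of the image from the
      isomorphism itself, so they must be the projections of the path graph.\<close>
    have tl: "iso_tail h = fst" and hd: "iso_head h = snd"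
      using arg_cong[OF app, of tail] arg_cong[OF app, of head]
      by (simp_all add: tail_app_iso head_app_iso)
    define f where "f = the_inv_into (verts H) ?v"
    have fin: "f i \<in> verts H" and vf: "?v (f i) = i" if "i < 4" for i
      using that the_inv_into_into[OF inj, of i "verts H"] f_the_inv_into_f[OF inj, of i]
      unfolding f_def by (auto simp: vimg)
    have "inj_on f {..<4}" by (rule inj_on_inverseI[of _ ?v]) (simp add: vf)
    moreover have "f ` {..<4} \<subseteq> pverts G" using fin sub by auto
    moreover have "(f i, f j) \<in> parcs G \<longleftrightarrow> (i, j) \<in> parcs (path_graph 4)" if ij: "i < 4" "j < 4" for i j
    proof
      assume "(f i, f j) \<in> parcs G"
      then have "(f i, f j) \<in> arcs H" using fin ij by (simp add: arcsH)
      then show "(i, j) \<in> parcs (path_graph 4)"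
        using ends[of "(f i, f j)"] aimg by (metis fst_conv hd imageI prod.collapse snd_conv tl vf ij)
    next
      assume "(i, j) \<in> parcs (path_graph 4)"
      then obtain e where e: "e \<in> arcs H" "?a e = (i, j)" using aimg by (metis imageE)
      have "fst e = f i" "snd e = f j"
        using ends[OF e(1)] e(1) fin vf ij inj by (auto simp: e(2) tl hd arcsH inj_on_def)
      then show "(f i, f j) \<in> parcs G" using e(1) by (metis (no_types, lifting) arcsH mem_Collect_eq prod.collapse)
    qed
    ultimately show ?thesis by blast
  qed
  have no_path: "\<not> cograph (with_proj G)" if f: "?path f" for f
  proof -
    let ?H = "with_proj G \<restriction> (f ` {..<4})"
    have ind: "induced_subgraph ?H (with_proj G)"
      using f by (intro induced_induce) auto
    then have wf: "wf_digraph ?H" unfolding induced_subgraph_def subgraph_def by blast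
    define g where "g = the_inv_into {..<4} f"
    have gf: "g (f i) = i" if "i < 4" for i
      using f that unfolding g_def by (intro the_inv_into_f_f) auto
    \<comment> \<open>Acting on arcs componentwise by \<open>g\<close> makes the image a pair
      digraph again.\<close>
    define h where "h = \<lparr> iso_verts = g, iso_arcs = map_prod g g, iso_head = snd, iso_tail = fst \<rparr>"
    have g_inj: "inj_on g (f ` {..<4})" by (rule inj_on_inverseI[of _ f]) (auto simp: gf)
    have arcsH: "arcs ?H = map_prod f f ` parcs (path_graph 4)"
      using f by (force simp: path_graph_def)
    have "pre_digraph.digraph_isomorphism ?H h"
      using wf g_inj unfolding pre_digraph.digraph_isomorphism_def arcsH
      by (auto simp: h_def inj_on_def gf path_graph_def)
    moreover have "map_prod g g ` arcs ?H = parcs (path_graph 4)"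
      unfolding arcsH by (force simp: path_graph_def gf image_iff)
    then have "with_proj (path_graph 4) = app_iso h ?H"
      by (auto simp: app_iso_def h_def with_proj_def path_graph_def gf image_image)
    ultimately have "digraph_iso ?H (with_proj (path_graph 4))" unfolding digraph_iso_def by blast
    with ind show ?thesis unfolding cograph_def by blast
  qed
  show ?thesis
  proof
    assume "cograph (with_proj G)"
    then show "\<nexists>f. ?path f" using no_path by blast
  next
    assume "\<nexists>f. ?path f"
    then show "cograph (with_proj G)" unfolding cograph_def using path by blast
  qed
qed

text \<open>The distinctness of the four vertices of a path follows from the intersection pattern.\<close>

lemma cograph_intersection_subgroup_graph_iff:
  "cograph (with_proj (intersection_subgroup_graph G)) \<longleftrightarrow>
    \<not> (\<exists>A B C D. {A, B, C, D} \<subseteq> nontrivial_subgroups G \<and>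
      A \<inter> B = {\<one>\<^bsub>G\<^esub>} \<and> B \<inter> C = {\<one>\<^bsub>G\<^esub>} \<and> C \<inter> D = {\<one>\<^bsub>G\<^esub>} \<and>
      A \<inter> C \<noteq> {\<one>\<^bsub>G\<^esub>} \<and> A \<inter> D \<noteq> {\<one>\<^bsub>G\<^esub>} \<and> B \<inter> D \<noteq> {\<one>\<^bsub>G\<^esub>})"
    (is "_ \<longleftrightarrow> \<not> (\<exists>A B C D. ?path A B C D)")
proof -
  let ?I = "intersection_subgroup_graph G"
  interpret pair_bidirected_digraph ?I by (rule pair_bidirected_intersection_subgroup_graph)
  have arcs: "(H, K) \<in> parcs ?I \<longleftrightarrow>
      H \<in> nontrivial_subgroups G \<and> K \<in> nontrivial_subgroups G \<and> H \<noteq> K \<and> H \<inter> K = {\<one>\<^bsub>G\<^esub>}" for H K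
    by (auto simp: intersection_subgroup_graph_def Let_def)
  have verts: "H \<in> pverts ?I \<Longrightarrow> H \<in> nontrivial_subgroups G" for H
    by (simp add: intersection_subgroup_graph_def Let_def)
  have vertsI: "H \<in> pverts ?I"
    if "H \<in> nontrivial_subgroups G" "K \<in> nontrivial_subgroups G" "H \<inter> K = {\<one>\<^bsub>G\<^esub>}" for H K
    using that by (auto simp: intersection_subgroup_graph_def Let_def)
  have path: "?path (f 0) (f 1) (f 2) (f 3)"
    if "inj_on f {..<4}" "f ` {..<4} \<subseteq> pverts ?I"
      "\<forall>i<4. \<forall>j<4. (f i, f j) \<in> parcs ?I \<longleftrightarrow> (i, j) \<in> parcs (path_graph 4)" for f
  proof -
    have N: "f i \<in> nontrivial_subgroups G" if "i < 4" for i
      using that verts \<open>f ` {..<4} \<subseteq> pverts ?I\<close> by auto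
    have "f i \<inter> f j = {\<one>\<^bsub>G\<^esub>} \<longleftrightarrow> j = Suc i \<or> i = Suc j" if "i < 4" "j < 4" "i \<noteq> j" for i j
    proof -
      have "f i \<noteq> f j" using that \<open>inj_on f {..<4}\<close> by (auto dest: inj_onD)
      moreover have "(f i, f j) \<in> parcs ?I \<longleftrightarrow> j = Suc i \<or> i = Suc j"
        using that \<open>\<forall>i<4. \<forall>j<4. _ i j\<close> by (simp add: path_graph_def)
      ultimately show ?thesis using that N by (simp add: arcs)
    qed
    then show ?thesis using N by simp
  qed
  have embed: "\<exists>f. inj_on f {..<4} \<and> f ` {..<4} \<subseteq> pverts ?I \<and>
      (\<forall>i<4. \<forall>j<4. (f i, f j) \<in> parcs ?I \<longleftrightarrow> (i, j) \<in> parcs (path_graph 4))"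
    if p: "?path A B C D" for A B C D
  proof -
    have four: "i < 4 \<longleftrightarrow> i = 0 \<or> i = 1 \<or> i = 2 \<or> i = 3" for i :: nat by linarith
    then have lt4: "{..<4} = {0, 1, 2, 3 :: nat}"
      unfolding set_eq_iff lessThan_iff insert_iff empty_iff by blast
    define f where "f = (\<lambda>i::nat. [A, B, C, D] ! i)"
    have f: "f 0 = A" "f 1 = B" "f (Suc 0) = B" "f 2 = C" "f 3 = D" by (simp_all add: f_def numeral_3_eq_3)
    have N: "A \<in> nontrivial_subgroups G" "B \<in> nontrivial_subgroups G"
        "C \<in> nontrivial_subgroups G" "D \<in> nontrivial_subgroups G"
      using p by simp_all
    have int: "A \<inter> B = {\<one>\<^bsub>G\<^esub>}" "B \<inter> A = {\<one>\<^bsub>G\<^esub>}" "B \<inter> C = {\<one>\<^bsub>G\<^esub>}" "C \<inter> B = {\<one>\<^bsub>G\<^esub>}"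
        "C \<inter> D = {\<one>\<^bsub>G\<^esub>}" "D \<inter> C = {\<one>\<^bsub>G\<^esub>}" "A \<inter> C \<noteq> {\<one>\<^bsub>G\<^esub>}" "C \<inter> A \<noteq> {\<one>\<^bsub>G\<^esub>}"
        "A \<inter> D \<noteq> {\<one>\<^bsub>G\<^esub>}" "D \<inter> A \<noteq> {\<one>\<^bsub>G\<^esub>}" "B \<inter> D \<noteq> {\<one>\<^bsub>G\<^esub>}" "D \<inter> B \<noteq> {\<one>\<^bsub>G\<^esub>}"
      using p by (simp_all add: Int_commute)
    have ne: "A \<noteq> {\<one>\<^bsub>G\<^esub>}" "B \<noteq> {\<one>\<^bsub>G\<^esub>}" "C \<noteq> {\<one>\<^bsub>G\<^esub>}" "D \<noteq> {\<one>\<^bsub>G\<^esub>}"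
      using N by (simp_all add: nontrivial_subgroups_def)
    \<comment> \<open>Equal adjacent subgroups would be trivial. Of the other pairs,
      \<open>A = C\<close> and \<open>A = D\<close> conflict with \<open>C \<inter> D\<close> being
      trivial, and \<open>B = D\<close> conflicts with \<open>A \<inter> B\<close> being
      trivial.\<close>
    have dist: "A \<noteq> B" "A \<noteq> C" "A \<noteq> D" "B \<noteq> C" "B \<noteq> D" "C \<noteq> D"
      using int ne by force+
    have "inj_on f {..<4}" unfolding lt4 using dist by (simp add: f)
    moreover have "f ` {..<4} \<subseteq> pverts ?I"
      using vertsI[OF N(1,2) int(1)] vertsI[OF N(2,1) int(2)] vertsI[OF N(3,2) int(4)]
        vertsI[OF N(4,3) int(6)]
      unfolding lt4 by (simp add: f)
    moreover have "\<forall>i<4. \<forall>j<4. (f i, f j) \<in> parcs ?I \<longleftrightarrow> (i, j) \<in> parcs (path_graph 4)"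
      unfolding four arcs path_graph_def
      by (intro allI impI, elim disjE) (simp_all add: f N int dist dist[symmetric])
    ultimately show ?thesis by blast
  qed
  show ?thesis
    unfolding cograph_with_proj_iff[OF pair_wf_digraph_axioms]
  proof (intro arg_cong[of _ _ Not] iffI; elim exE)
    fix f
    assume "inj_on f {..<4} \<and> f ` {..<4} \<subseteq> pverts ?I \<and>
      (\<forall>i<4. \<forall>j<4. (f i, f j) \<in> parcs ?I \<longleftrightarrow> (i, j) \<in> parcs (path_graph 4))"
    then show "\<exists>A B C D. ?path A B C D" by (elim conjE) (intro exI, rule path)
  qed (rule embed)
qed

section \<open>Finite groups with at most one exceptional subgroup\<close>

context group
begin

lemma card_subgroup_dvd: "subgroup H G \<Longrightarrow> card H dvd card (carrier G)"
  using lagrange[of H] by (metis dvd_triv_right order_def)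

lemma subgroup_card_one: "subgroup H G \<Longrightarrow> card H = 1 \<Longrightarrow> H = {\<one>}"
  using subgroup.one_closed by (fastforce simp: card_1_singleton_iff)

lemma subgroup_card_carrier:
  "subgroup H G \<Longrightarrow> finite (carrier G) \<Longrightarrow> card H = card (carrier G) \<Longrightarrow> H = carrier G"
  by (meson card_subset_eq subgroup.subset)

text \<open>By Lagrange the non-trivial intersection has the full prime order in each of the two
  subgroups, hence coincides with both.\<close>

lemma prime_card_subgroups_inter:
  assumes fin: "finite (carrier G)" and A: "subgroup A G" "prime (card A)"
    and C: "subgroup C G" "prime (card C)" and AC: "A \<inter> C \<noteq> {\<one>}"
  shows "A = C"
proof -
  have inter_eq: "H \<inter> K = H"
    if H: "subgroup H G" "prime (card H)" and K: "subgroup K G" and HK: "H \<inter> K \<noteq> {\<one>}" for H K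
  proof -
    have sub: "subgroup (H \<inter> K) G" using subgroups_Inter_pair[OF H(1) K] .
    have finH: "finite H" using fin subgroup.subset[OF H(1)] finite_subset by blast
    have "subgroup (H \<inter> K) (G\<lparr>carrier := H\<rparr>)"
      by (rule subgroup_incl[OF sub H(1)]) simp
    then have "card (H \<inter> K) dvd card H"
      using group.card_subgroup_dvd[OF subgroup.subgroup_is_group[OF H(1) group_axioms]] by simp
    moreover have "card (H \<inter> K) \<noteq> 1"
      using HK subgroup_card_one[OF sub] by blast
    ultimately have "card (H \<inter> K) = card H" using H(2) prime_nat_iff by blast
    then show ?thesis using finH by (intro card_subset_eq) auto
  qed
  show ?thesis
    using inter_eq[OF A C(1) AC] inter_eq[OF C A(1)] AC by (simp add: Int_commute)
qed

text \<open>
  Distinct subgroups of prime order meet trivially, so \<open>W\<close> would have to occur in both non-adjacent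
  pairs \<open>{A, C}\<close> and \<open>{B, D}\<close> of an induced path \<open>A - B - C - D\<close>.
\<close>

lemma cographI:
  assumes fin: "finite (carrier G)"
    and prime: "\<And>H. subgroup H G \<Longrightarrow> H \<notin> {{\<one>}, carrier G, W} \<Longrightarrow> prime (card H)"
  shows "cograph (with_proj (intersection_subgroup_graph G))"
  unfolding cograph_intersection_subgroup_graph_iff
proof (rule notI, elim exE conjE)
  fix A B C D
  assume N: "{A, B, C, D} \<subseteq> nontrivial_subgroups G"
    and AB: "A \<inter> B = {\<one>}" and BC: "B \<inter> C = {\<one>}" and CD: "C \<inter> D = {\<one>}"
    and AC: "A \<inter> C \<noteq> {\<one>}" and AD: "A \<inter> D \<noteq> {\<one>}" and BD: "B \<inter> D \<noteq> {\<one>}"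
  have sub: "subgroup H G" and nt: "H \<noteq> {\<one>}" if "H \<in> {A, B, C, D}" for H
    using N that by (auto simp: nontrivial_subgroups_def)
  \<comment> \<open>The whole group meets \<open>K\<close> in \<open>K\<close> itself, so it has no
    neighbour in the graph.\<close>
  have proper: "H \<noteq> carrier G" if "H \<in> {A, B, C, D}" "K \<in> {A, B, C, D}" "H \<inter> K = {\<one>}" for H K
    using that nt[of K] subgroup.subset[OF sub[of K]] by auto
  have prime': "prime (card H)"
    if "H \<in> {A, B, C, D}" "K \<in> {A, B, C, D}" "H \<inter> K = {\<one>}" "H \<noteq> W" for H K
    using prime[OF sub[OF that(1)]] proper[OF that(1-3)] nt[OF that(1)] that(4) by blast
  have "A = W \<or> C = W"
  proof (rule ccontr)
    assume "\<not> (A = W \<or> C = W)"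
    then have "A = C"
      using AB CD by (intro prime_card_subgroups_inter[OF fin sub prime'[of A B] sub prime'[of C D] AC]) simp_all
    then show False using AD CD by simp
  qed
  moreover have "B = W \<or> D = W"
  proof (rule ccontr)
    assume "\<not> (B = W \<or> D = W)"
    then have "B = D"
      using BC CD by (intro prime_card_subgroups_inter[OF fin sub prime'[of B C] sub prime'[of D C] BD])
        (simp_all add: Int_commute)
    then show False using AB AD by simp
  qed
  \<comment> \<open>\<open>W\<close> is one of \<open>A\<close>, \<open>C\<close> and one of
    \<open>B\<close>, \<open>D\<close>. Three of the four combinations identify adjacent subgroups;
    the fourth, \<open>A = D\<close>, conflicts with \<open>A \<inter> C\<close> being non-trivial
    and \<open>C \<inter> D\<close> trivial.\<close>
  ultimately show False
    using AB AC AD BC BD CD nt[of A] nt[of B] nt[of C] by (elim disjE) (simp_all add: Int_commute)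
qed

text \<open>For \<open>g\<close> outside \<open>H\<close>, counting shows that the coset
  \<open>H #> g\<close> is the complement of \<open>H\<close>. If the square of \<open>g\<close> lay
  in that coset, cancelling \<open>g\<close> would put \<open>g\<close> into
  \<open>H\<close>.\<close>

lemma square_in_subgroup_of_index_2:
  assumes H: "subgroup H G" and fin: "finite (carrier G)"
    and index: "2 * card H = card (carrier G)" and g: "g \<in> carrier G"
  shows "g \<otimes> g \<in> H"
proof (cases "g \<in> H")
  case True
  then show ?thesis using subgroup.m_closed[OF H] by blast
next
  case False
  have HG: "H \<subseteq> carrier G" by (rule subgroup.subset[OF H])
  have KG: "H #> g \<subseteq> carrier G" using HG g by (rule r_coset_subset_G)
  have disj: "H \<inter> (H #> g) = {}"
    using False H g repr_independence[OF _ g H] rcos_self[OF g H]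
    by (metis coset_join1 coset_join2 disjoint_iff HG subgroup.mem_carrier)
  have "card (H #> g) = card H"
    using card_rcosets_equal[OF rcosetsI[OF HG g] HG] by simp
  then have "card (H \<union> (H #> g)) = card (carrier G)"
    using disj HG KG fin index by (subst card_Un_disjoint) (auto intro: finite_subset)
  then have "H \<union> (H #> g) = carrier G"
    using HG KG fin by (intro card_subset_eq) auto
  moreover have "g \<otimes> g \<notin> H #> g"
  proof
    assume "g \<otimes> g \<in> H #> g"
    then obtain h where "h \<in> H" "g \<otimes> g = h \<otimes> g" unfolding r_coset_def by blast
    then show False using False HG g by auto
  qed
  ultimately show ?thesis using g by blast
qed

text \<open>
  Outside \<open>V\<close> every element satisfies \<open>g = (g\<^sup>2)\<^sup>2\<close>, so a subgroup of order 6, containing all squares,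
  would contain the at least 8 elements outside \<open>V\<close>; a subgroup of order 4 must be \<open>V\<close> itself.
\<close>

lemma subgroups_of_order_12:
  assumes order: "card (carrier G) = 12" and V: "card V \<le> 4" "finite V" "\<one> \<in> V"
    and cube: "\<And>g. g \<in> carrier G \<Longrightarrow> g \<notin> V \<Longrightarrow> g \<otimes> g \<otimes> g = \<one>"
    and H: "subgroup H G" "H \<notin> {{\<one>}, carrier G, V}"
  shows "prime (card H)"
proof -
  have fin: "finite (carrier G)" using order by (rule_tac card_ge_0_finite) simp
  have HG: "H \<subseteq> carrier G" by (rule subgroup.subset[OF H(1)])
  have finH: "finite H" using HG fin by (rule finite_subset)
  have "card H \<noteq> 6"
  proof
    assume six: "card H = 6"
    have "g \<in> H" if g: "g \<in> carrier G - V" for g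
    proof -
      have "(g \<otimes> g) \<otimes> (g \<otimes> g) \<in> H"
        using g six order by (intro square_in_subgroup_of_index_2[OF H(1) fin]) auto
      moreover have "(g \<otimes> g) \<otimes> (g \<otimes> g) = g"
        using g cube[of g] by (metis DiffD1 DiffD2 m_assoc m_closed r_one)
      ultimately show ?thesis by simp
    qed
    then have "card (carrier G - V) \<le> card H" using finH by (intro card_mono) auto
    moreover have "card (carrier G) - card V \<le> card (carrier G - V)"
      using V(2) by (rule diff_card_le_card_Diff)
    ultimately show False using six order V by simp
  qed
  moreover have "card H \<noteq> 4"
  proof
    assume four: "card H = 4"
    \<comment> \<open>Outside \<open>V\<close> the cube of \<open>g\<close> is trivial, while order
      4 of \<open>H\<close> makes the fourth power trivial; together they force
      \<open>g = \<one>\<close>, which does lie in \<open>V\<close>.\<close>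
    have "g \<in> V" if g: "g \<in> H" for g
    proof (rule ccontr)
      assume "g \<notin> V"
      have gG: "g \<in> carrier G" using g HG by blast
      interpret H: group "G\<lparr>carrier := H\<rparr>" by (rule subgroup.subgroup_is_group[OF H(1) group_axioms])
      have pow4: "g [^] (4::nat) = g \<otimes> g \<otimes> g \<otimes> g" using gG by (simp add: eval_nat_numeral)
      have "g [^] (4::nat) = \<one>"
        using H.pow_order_eq_1[of g] g four by (simp add: order_def flip: nat_pow_consistent)
      then have "g = \<one>" using cube[OF gG \<open>g \<notin> V\<close>] gG by (simp add: pow4)
      then show False using V(3) \<open>g \<notin> V\<close> by simp
    qed
    then have "H = V" using V four by (intro card_seteq) auto
    then show False using H(2) by simp
  qed
  moreover have "card H \<noteq> 1" "card H \<noteq> 12"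
    using subgroup_card_one[OF H(1)] subgroup_card_carrier[OF H(1) fin] H(2) order by auto
  moreover have "card H dvd 12" using card_subgroup_dvd[OF H(1)] order by simp
  then have "card H \<in> {1, 2, 3, 4, 6, 12}"
  proof -
    have "card H \<le> 12" using \<open>card H dvd 12\<close> by (auto dest: dvd_imp_le)
    then have "card H \<in> {..12}" by simp
    then show ?thesis using \<open>card H dvd 12\<close> by (auto simp: atMost_nat_numeral)
  qed
  ultimately have "card H = 2 \<or> card H = 3" by blast
  then show ?thesis by auto
qed

end

section \<open>Induced paths in the larger symmetric and alternating groups\<close>

text \<open>The elements \<open>x\<close>, \<open>y\<close>, \<open>z\<close> witness the three
  non-trivial intersections and at the same time the non-triviality of all four subgroups.\<close>

lemma (in group) not_cographI:
  assumes sub: "subgroup A G" "subgroup B G" "subgroup C G" "subgroup D G"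
    and disj: "A \<inter> B \<subseteq> {\<one>}" "B \<inter> C \<subseteq> {\<one>}" "C \<inter> D \<subseteq> {\<one>}"
    and x: "x \<in> A \<inter> C" "x \<noteq> \<one>" and y: "y \<in> A \<inter> D" "y \<noteq> \<one>" and z: "z \<in> B \<inter> D" "z \<noteq> \<one>"
  shows "\<not> cograph (with_proj (intersection_subgroup_graph G))"
proof -
  have "A \<inter> B = {\<one>}" "B \<inter> C = {\<one>}" "C \<inter> D = {\<one>}"
    using disj sub[THEN subgroup.one_closed] by blast+
  moreover have "A \<inter> C \<noteq> {\<one>}" "A \<inter> D \<noteq> {\<one>}" "B \<inter> D \<noteq> {\<one>}" using x y z by blast+
  moreover have "{A, B, C, D} \<subseteq> nontrivial_subgroups G"
    using sub x y z by (auto simp: nontrivial_subgroups_def)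
  ultimately show ?thesis unfolding cograph_intersection_subgroup_graph_iff by blast
qed

text \<open>The choice \<open>B = {}\<close> imposes no condition and gives the full symmetric group
  on \<open>A\<close>, so one definition serves all subgroups on the paths. \<open>B\<close> may
  reach outside \<open>A\<close>.\<close>

definition stabiliser :: "nat set \<Rightarrow> nat set \<Rightarrow> (nat \<Rightarrow> nat) set" where
  "stabiliser A B = {p. p permutes A \<and> p ` B = B}"

lemma subgroup_stabiliser:
  assumes "A \<subseteq> {1..n}"
  shows "subgroup (stabiliser A B) (sym_group n)"
proof (rule group.subgroupI[OF sym_group_is_group])
  have carrier: "p \<in> carrier (sym_group n)" if "p \<in> stabiliser A B" for p
    using that assms by (auto simp: stabiliser_def sym_group_carrier intro: permutes_subset)
  then show "stabiliser A B \<subseteq> carrier (sym_group n)" by blast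
  have "id \<in> stabiliser A B" by (simp add: stabiliser_def permutes_id)
  then show "stabiliser A B \<noteq> {}" by blast
  fix p q assume p: "p \<in> stabiliser A B"
  then have "inv' p ` B = B"
    using permutes_inj[of p A] by (auto simp: stabiliser_def) (metis image_inv_f_f image_eqI)+
  then show "inv\<^bsub>sym_group n\<^esub> p \<in> stabiliser A B"
    using p carrier[OF p] by (simp add: stabiliser_def permutes_inv)
  assume "q \<in> stabiliser A B"
  with p show "p \<otimes>\<^bsub>sym_group n\<^esub> q \<in> stabiliser A B"
    by (simp add: stabiliser_def sym_group_mult permutes_compose flip: image_image)
qed

text \<open>This is the intersection of two subgroups of the symmetric group, and it lies inside the
  alternating group. For \<open>B = {}\<close> it is the alternating group on
  \<open>A\<close>.\<close>

lemma subgroup_even_stabiliser: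
  assumes "A \<subseteq> {1..n}"
  shows "subgroup (stabiliser A B \<inter> Collect evenperm) (sym_group n)"
    and "subgroup (stabiliser A B \<inter> Collect evenperm) (alt_group n)"
proof -
  have eq: "stabiliser A B \<inter> Collect evenperm = stabiliser A B \<inter> carrier (alt_group n)"
    using subgroup.subset[OF subgroup_stabiliser[OF assms, of B]]
    by (auto simp: alt_group_carrier sym_group_carrier)
  show sym: "subgroup (stabiliser A B \<inter> Collect evenperm) (sym_group n)"
    unfolding eq by (intro group.subgroups_Inter_pair sym_group_is_group subgroup_stabiliser assms
        alt_group_is_subgroup)
  have "alt_group n = sym_group n\<lparr>carrier := carrier (alt_group n)\<rparr>"
    by (simp add: alt_group_def)
  then show "subgroup (stabiliser A B \<inter> Collect evenperm) (alt_group n)"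
    using group.subgroup_incl[OF sym_group_is_group sym alt_group_is_subgroup] by (simp add: eq)
qed

lemma permutes_Int: "p permutes A \<Longrightarrow> p permutes B \<Longrightarrow> p permutes A \<inter> B"
  by (rule permutes_superset[of p A]) (auto simp: permutes_not_in)

text \<open>Such a \<open>p\<close> preserves both \<open>A\<close> and \<open>B\<close>, hence also
  \<open>A \<inter> B\<close> and \<open>A - B\<close>; a singleton among these is a fixed
  point.\<close>

lemma stabiliser_fixes:
  assumes p: "p \<in> stabiliser A B" and c: "A \<inter> B = {c} \<or> A - B = {c}"
  shows "p c = c"
proof -
  have "p permutes A" "p ` B = B" "inj p" using p permutes_inj by (auto simp: stabiliser_def)
  moreover have "p c \<in> B \<longleftrightarrow> c \<in> B"
    using \<open>p ` B = B\<close> \<open>inj p\<close> by (metis inj_image_mem_iff)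
  moreover have "p c \<in> A \<longleftrightarrow> c \<in> A" using \<open>p permutes A\<close> by (rule permutes_in_image)
  ultimately show ?thesis using c by blast
qed

lemma even_permutes_doubleton: "p permutes {a, b} \<Longrightarrow> evenperm p \<Longrightarrow> p = id"
  by (auto simp: permutes_doubleton_iff evenperm_swap)

lemma evenperm_transpose_comp:
  "a \<noteq> b \<Longrightarrow> c \<noteq> d \<Longrightarrow> evenperm (transpose a b \<circ> transpose c d)"
  by (simp add: evenperm_comp permutation_swap_id evenperm_swap)

lemma not_cograph_sym_group:
  assumes n: "n \<ge> 4"
  shows "\<not> cograph (with_proj (intersection_subgroup_graph (sym_group n)))"
proof (rule group.not_cographI[OF sym_group_is_group])
  let ?A = "stabiliser {1, 2, 3, 4} {1, 2}" and ?B = "stabiliser {1, 2, 3} {} \<inter> Collect evenperm"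
  let ?C = "stabiliser {3, 4} {}" and ?D = "stabiliser {1, 2, 3} {}"
  show "subgroup ?A (sym_group n)" "subgroup ?B (sym_group n)"
    "subgroup ?C (sym_group n)" "subgroup ?D (sym_group n)"
    using n by (auto intro!: subgroup_stabiliser subgroup_even_stabiliser)
  \<comment> \<open>Stabilising \<open>{1, 2}\<close> fixes the remaining point 3, which leaves an
    even permutation of two points.\<close>
  have "p = id" if p: "p permutes {1, 2, 3}" "p ` {1, 2} = {1, 2}" "evenperm p" for p :: "nat \<Rightarrow> nat"
  proof -
    have "p \<in> stabiliser {1, 2, 3} {1, 2}" using p by (simp add: stabiliser_def)
    then have "p 3 = 3" by (rule stabiliser_fixes) auto
    then have "p permutes {1, 2}" by (intro permutes_superset[OF p(1)]) auto
    then show ?thesis using p(3) by (rule even_permutes_doubleton)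
  qed
  then show "?A \<inter> ?B \<subseteq> {\<one>\<^bsub>sym_group n\<^esub>}"
    by (auto simp: sym_group_one stabiliser_def)
  \<comment> \<open>The supports share only the point 3. As \<open>?B\<close> lies in
    \<open>?D\<close>, this settles both remaining intersections.\<close>
  have "p = id" if "p permutes {1, 2, 3}" "p permutes {3, 4}" for p :: "nat \<Rightarrow> nat"
    using permutes_Int[OF that] by simp
  then show "?B \<inter> ?C \<subseteq> {\<one>\<^bsub>sym_group n\<^esub>}" "?C \<inter> ?D \<subseteq> {\<one>\<^bsub>sym_group n\<^esub>}"
    by (auto simp: sym_group_one stabiliser_def)
  show "transpose 3 4 \<in> ?A \<inter> ?C" "transpose 1 2 \<in> ?A \<inter> ?D"
    by (auto simp: stabiliser_def permutes_swap_id)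
  show "transpose 1 2 \<circ> transpose 2 3 \<in> ?B \<inter> ?D"
    by (auto simp: stabiliser_def evenperm_transpose_comp intro!: permutes_compose permutes_swap_id)
  show "transpose 3 4 \<noteq> \<one>\<^bsub>sym_group n\<^esub>" "transpose 1 2 \<noteq> \<one>\<^bsub>sym_group n\<^esub>"
    "transpose 1 2 \<circ> transpose 2 3 \<noteq> \<one>\<^bsub>sym_group n\<^esub>"
    by (auto simp: sym_group_one fun_eq_iff transpose_def)
qed

lemma not_cograph_alt_group:
  assumes n: "n \<ge> 5"
  shows "\<not> cograph (with_proj (intersection_subgroup_graph (alt_group n)))"
proof (rule group.not_cographI[OF alt_group_is_group])
  let ?A = "stabiliser {1, 2, 3, 4} {} \<inter> Collect evenperm"
  let ?B = "stabiliser {1, 2, 5} {} \<inter> Collect evenperm"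
  let ?C = "stabiliser {1, 3, 4} {} \<inter> Collect evenperm"
  let ?D = "stabiliser {1, 2, 3, 4, 5} {1, 2, 5} \<inter> Collect evenperm"
  show "subgroup ?A (alt_group n)" "subgroup ?B (alt_group n)"
    "subgroup ?C (alt_group n)" "subgroup ?D (alt_group n)"
    using n by (auto intro!: subgroup_even_stabiliser)
  \<comment> \<open>Only the points 1 and 2 can move, and the swap of two points is odd.\<close>
  have "p = id" if "p permutes {1, 2, 3, 4}" "p permutes {1, 2, 5}" "evenperm p" for p :: "nat \<Rightarrow> nat"
    using permutes_Int[OF that(1,2)] that(3) even_permutes_doubleton[of p 1 2] by simp
  then show "?A \<inter> ?B \<subseteq> {\<one>\<^bsub>alt_group n\<^esub>}"
    by (auto simp: alt_group_one stabiliser_def)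
  have "p = id" if "p permutes {1, 2, 5}" "p permutes {1, 3, 4}" for p :: "nat \<Rightarrow> nat"
    using permutes_Int[OF that] by simp
  then show "?B \<inter> ?C \<subseteq> {\<one>\<^bsub>alt_group n\<^esub>}"
    by (auto simp: alt_group_one stabiliser_def)
  \<comment> \<open>The set \<open>{1, 2, 5}\<close> meets \<open>{1, 3, 4}\<close> only in 1, so 1
    is fixed and an even permutation of \<open>{3, 4}\<close> remains.\<close>
  have "p = id" if p: "p permutes {1, 3, 4}" "p ` {1, 2, 5} = {1, 2, 5}" "evenperm p" for p :: "nat \<Rightarrow> nat"
  proof -
    have "p \<in> stabiliser {1, 3, 4} {1, 2, 5}" using p by (simp add: stabiliser_def)
    then have "p 1 = 1" by (rule stabiliser_fixes) auto
    then have "p permutes {3, 4}" by (intro permutes_superset[OF p(1)]) auto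
    then show ?thesis using p(3) by (rule even_permutes_doubleton)
  qed
  then show "?C \<inter> ?D \<subseteq> {\<one>\<^bsub>alt_group n\<^esub>}"
    by (auto simp: alt_group_one stabiliser_def)
  show "transpose 1 3 \<circ> transpose 3 4 \<in> ?A \<inter> ?C"
    by (auto simp: stabiliser_def evenperm_transpose_comp intro!: permutes_compose permutes_swap_id)
  \<comment> \<open>The swap of 3 and 4 compensates the odd swap inside \<open>{1, 2, 5}\<close>;
    the other two witnesses are 3-cycles.\<close>
  show "transpose 1 2 \<circ> transpose 3 4 \<in> ?A \<inter> ?D"
    by (auto simp: stabiliser_def evenperm_transpose_comp intro!: permutes_compose permutes_swap_id)
  show "transpose 1 2 \<circ> transpose 2 5 \<in> ?B \<inter> ?D"
    by (auto simp: stabiliser_def evenperm_transpose_comp intro!: permutes_compose permutes_swap_id)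
  show "transpose 1 3 \<circ> transpose 3 4 \<noteq> \<one>\<^bsub>alt_group n\<^esub>" "transpose 1 2 \<circ> transpose 3 4 \<noteq> \<one>\<^bsub>alt_group n\<^esub>"
    "transpose 1 2 \<circ> transpose 2 5 \<noteq> \<one>\<^bsub>alt_group n\<^esub>"
    by (auto simp: alt_group_one fun_eq_iff transpose_def)
qed

section \<open>The small groups\<close>

lemma cograph_sym_group_3: "cograph (with_proj (intersection_subgroup_graph (sym_group 3)))"
proof -
  interpret group "sym_group 3" by (rule sym_group_is_group)
  have card: "card (carrier (sym_group 3)) = 6"
    by (simp add: sym_group_card_carrier fact_numeral)
  then have fin: "finite (carrier (sym_group 3))" by (rule_tac card_ge_0_finite) simp
  show ?thesis
  \<comment> \<open>Taking the whole group as \<open>W\<close> means that no exception is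
    made.\<close>
  proof (rule cographI[OF fin])
    fix H assume H: "subgroup H (sym_group 3)"
      "H \<notin> {{\<one>\<^bsub>sym_group 3\<^esub>}, carrier (sym_group 3), carrier (sym_group 3)}"
    have "card H dvd 6" using card_subgroup_dvd[OF H(1)] card by simp
    moreover from this have "card H \<in> {..6}" by (auto dest: dvd_imp_le)
    moreover have "card H \<noteq> 1" "card H \<noteq> 6"
      using subgroup_card_one[OF H(1)] subgroup_card_carrier[OF H(1) fin] H(2) card by auto
    ultimately have "card H = 2 \<or> card H = 3" by (auto simp: atMost_nat_numeral)
    then show "prime (card H)" by auto
  qed
qed

text \<open>The order is 1 or 3, so there are no proper non-trivial subgroups and the primality
  condition is vacuous; the graph is null.\<close>

lemma cograph_alt_group_le_3:
  assumes n: "n \<le> 3"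
  shows "cograph (with_proj (intersection_subgroup_graph (alt_group n)))"
proof -
  interpret group "alt_group n" by (rule alt_group_is_group)
  have card: "card (carrier (alt_group n)) = 1 \<or> card (carrier (alt_group n)) = 3"
  proof (cases "n \<ge> 2")
    case True
    then have "n = 2 \<or> n = 3" using n by auto
    then show ?thesis using alt_group_card_carrier[OF True] by (auto simp: fact_numeral)
  next
    case False
    then have "n = 0 \<or> n = 1" by auto
    then have "carrier (alt_group n) = {id}" by (auto simp: alt_group_def)
    then show ?thesis by simp
  qed
  then have fin: "finite (carrier (alt_group n))" by (rule_tac card_ge_0_finite) auto
  show ?thesis
  proof (rule cographI[OF fin])
    fix H assume H: "subgroup H (alt_group n)"
      "H \<notin> {{\<one>\<^bsub>alt_group n\<^esub>}, carrier (alt_group n), carrier (alt_group n)}"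
    have "card H = 1 \<or> card H = card (carrier (alt_group n))"
      using card_subgroup_dvd[OF H(1)] card prime_nat_iff[of 3] by auto
    then show "prime (card H)"
      using subgroup_card_one[OF H(1)] subgroup_card_carrier[OF H(1) fin] H(2) by auto
  qed
qed

text \<open>Elimination form of \<open>permutes_insert\<close>: for \<open>a\<close> outside
  \<open>S\<close>, \<open>b\<close> is the image of \<open>a\<close> and \<open>q\<close> is what
  remains after undoing that move.\<close>

lemma permutes_insertE:
  assumes "p permutes insert a S"
  obtains b q where "p = transpose a b \<circ> q" "b \<in> insert a S" "q permutes S"
proof -
  have "p \<in> {p. p permutes insert a S}" using assms by simp
  then show thesis unfolding permutes_insert by (auto intro: that)
qed

text \<open>Splitting off the points 4 and 3 leaves 24 products, of which parity keeps 12. Those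
  outside the Klein four-group are 3-cycles; each case is evaluated pointwise.\<close>

lemma alt_group_4_cases:
  assumes "p \<in> carrier (alt_group 4)"
  shows "p \<in> {id, transpose 1 2 \<circ> transpose 3 4, transpose 1 3 \<circ> transpose 2 4, transpose 1 4 \<circ> transpose 2 3}
    \<or> p \<circ> p \<circ> p = id"
proof -
  have p: "p permutes insert 4 (insert 3 {1, 2})" "evenperm p"
    using assms by (auto simp: alt_group_carrier insert_commute atLeastAtMost_insertL numeral_eq_Suc atLeastAtMostSuc_conv)
  obtain b c q where p_eq: "p = transpose 4 b \<circ> (transpose 3 c \<circ> q)"
    and b: "b \<in> {4, 3, 1, 2}" and c: "c \<in> {3, 1, 2}" and q: "q permutes {1, 2}"
    using p(1) by (metis permutes_insertE)
  have "permutation q" "evenperm q \<longleftrightarrow> q = id"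
    using q by (auto simp: permutes_doubleton_iff permutation_swap_id evenperm_swap)
  \<comment> \<open>Each of the three factors is either the identity or a single swap, so evenness
    means that the number of swaps is 0 or 2.\<close>
  then have "(b = 4) = ((c = 3) = (q = id))"
    using p(2) by (auto simp: p_eq evenperm_comp permutation_compose permutation_swap_id evenperm_swap)
  then show ?thesis
    using b c q unfolding p_eq permutes_doubleton_iff
    by (elim insertE emptyE disjE; simp add: fun_eq_iff transpose_def)
qed

lemma cograph_alt_group_4: "cograph (with_proj (intersection_subgroup_graph (alt_group 4)))"
proof -
  interpret group "alt_group 4" by (rule alt_group_is_group)
  define V :: "(nat \<Rightarrow> nat) set" where
    "V = {id, transpose 1 2 \<circ> transpose 3 4, transpose 1 3 \<circ> transpose 2 4, transpose 1 4 \<circ> transpose 2 3}"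
  have card: "card (carrier (alt_group 4)) = 12"
    using alt_group_card_carrier[of 4] by (simp add: fact_numeral)
  \<comment> \<open>The bound comes from the length of a list enumerating \<open>V\<close>, without
    comparing the permutations.\<close>
  have "card V \<le> 4"
    using card_length[of "[id, transpose 1 2 \<circ> transpose 3 4, transpose 1 3 \<circ> transpose 2 4,
      transpose 1 4 \<circ> transpose 2 3 :: nat \<Rightarrow> nat]"] by (simp add: V_def)
  show ?thesis
    using card alt_group_4_cases \<open>card V \<le> 4\<close>
    by (intro cographI[of V] subgroups_of_order_12[of V] card_ge_0_finite)
      (auto simp: V_def alt_group_mult alt_group_one)
qed

theorem theorem6p2:
  shows "(\<forall>n::nat. n \<ge> 3 \<longrightarrow>
            (cograph (with_proj (intersection_subgroup_graph (sym_group n))) \<longleftrightarrow> n = 3)) \<and>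
         (\<forall>n::nat. cograph (with_proj (intersection_subgroup_graph (alt_group n))) \<longleftrightarrow> n \<le> 4)"
proof (intro conjI allI impI)
  show "cograph (with_proj (intersection_subgroup_graph (sym_group n))) \<longleftrightarrow> n = 3"
    if "n \<ge> 3" for n :: nat
    using that cograph_sym_group_3 not_cograph_sym_group[of n] by (cases "n = 3") auto
  show "cograph (with_proj (intersection_subgroup_graph (alt_group n))) \<longleftrightarrow> n \<le> 4" for n :: nat
  proof -
    consider "n \<le> 3" | "n = 4" | "n \<ge> 5" by linarith
    then show ?thesis
      using cograph_alt_group_le_3[of n] cograph_alt_group_4 not_cograph_alt_group[of n] by cases auto
  qed
qed

end
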